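(* There exists an asymmetric cubic 3-connected graph $G$ of girth $5$ on $20$ vertices admitting a nontrivial partial automorphism $\varphi$ of deficiency $3$ (i.e. of rank $17$) such that $\operatorname{supp}(\varphi)$ has four vertices and $\operatorname{dom}(\varphi)$ splits as a disjoint union of a set $C$ with $|C|=5$ containing $\operatorname{supp}(\varphi)$ and a remainder $R$ with $|R|=12$, fixed pointwise by $\varphi$, joined to $C$ by exactly two edges of $G$. In particular, for $G$ the following assertion fails: "for every nontrivial partial automorphism $\varphi$ of deficiency $k\in\{1,2,3\}$ there is no partition $\operatorname{dom}(\varphi)=C\sqcup R$ such that $\operatorname{supp}(\varphi)\subseteq C$, the set $R$ is fixed pointwise by $\varphi$, $|R|\ge 6$, and at most $5-k$ edges join $C$ to $R$".
   Context: All graphs are finite, undirected and simple. A graph is asymmetric if its automorphism group is trivial. A partial automorphism $\varphi$ of a graph $G$ is an isomorphism between two induced subgraphs of $G$; $\operatorname{dom}(\varphi)$ and $\operatorname{ran}(\varphi)$ are the vertex sets of these subgraphs, $\operatorname{rank}(\varphi)=|\operatorname{dom}(\varphi)|$, and the deficiency of $\varphi$ is $|V(G)|-\operatorname{rank}(\varphi)$. It is nontrivial if $\varphi(x)\ne x$ for some $x\in\operatorname{dom}(\varphi)$. Its support is $\operatorname{supp}(\varphi)=\{v\in\operatorname{dom}(\varphi):\varphi(v)\ne v\}\cup\{v\in\operatorname{ran}(\varphi):\varphi^{-1}(v)\ne v\}$. *)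

theory Defs
  imports "Graph_Theory.Graph_Theory"
begin

text \<open>
  A finite simple undirected graph is a \<^locale>\<open>pair_graph\<close>: a finite, loop-free, symmetric
  digraph whose arcs are ordered pairs of vertices. Each undirected edge \<open>{u, v}\<close> is thus
  represented by the two arcs \<open>(u, v)\<close> and \<open>(v, u)\<close>, and the degree of a vertex is its out-degree.
\<close>

definition cubic :: "'a pair_pre_digraph \<Rightarrow> bool" where
  "cubic G \<longleftrightarrow> (\<forall>v\<in>pverts G. out_degree (with_proj G) v = 3)"

definition k_connected :: "nat \<Rightarrow> 'a pair_pre_digraph \<Rightarrow> bool" where
  "k_connected k G \<longleftrightarrow> card (pverts G) > k \<and>
     (\<forall>X\<subseteq>pverts G. card X < k \<longrightarrow> connected (with_proj G \<restriction> (pverts G - X)))"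

text \<open>
  The bound \<open>3 \<le> length p\<close> excludes the closed walks \<open>u, v, u\<close> along a single edge, which are
  cycles of the symmetric digraph but not of the undirected graph. The girth of a forest is
  \<open>\<infinity>\<close>.
\<close>

definition girth :: "'a pair_pre_digraph \<Rightarrow> enat" where
  "girth G = (INF p\<in>{p. pre_digraph.cycle (with_proj G) p \<and> 3 \<le> length p}. enat (length p))"

definition edges_between :: "'a pair_pre_digraph \<Rightarrow> 'a set \<Rightarrow> 'a set \<Rightarrow> 'a set set" where
  "edges_between G A B = {{u, v} | u v. u \<in> A \<and> v \<in> B \<and> (u, v) \<in> parcs G}"

text \<open>
  Isomorphisms of simple graphs as vertex maps; only the values on \<^term>\<open>verts G\<close> matter.
\<close>

definition graph_isomorphism ::
    "('a \<Rightarrow> 'c) \<Rightarrow> ('a, 'b) pre_digraph \<Rightarrow> ('c, 'd) pre_digraph \<Rightarrow> bool" where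
  "graph_isomorphism f G H \<longleftrightarrow> bij_betw f (verts G) (verts H) \<and>
     (\<forall>u\<in>verts G. \<forall>v\<in>verts G. u \<rightarrow>\<^bsub>G\<^esub> v \<longleftrightarrow> f u \<rightarrow>\<^bsub>H\<^esub> f v)"

definition asymmetric :: "'a pair_pre_digraph \<Rightarrow> bool" where
  "asymmetric G \<longleftrightarrow>
     (\<forall>f. graph_isomorphism f (with_proj G) (with_proj G) \<longrightarrow> (\<forall>v\<in>pverts G. f v = v))"

definition partial_automorphism :: "'a pair_pre_digraph \<Rightarrow> ('a \<rightharpoonup> 'a) \<Rightarrow> bool" where
  "partial_automorphism G \<phi> \<longleftrightarrow> dom \<phi> \<subseteq> pverts G \<and> ran \<phi> \<subseteq> pverts G \<and>
     graph_isomorphism (\<lambda>v. the (\<phi> v)) (with_proj G \<restriction> dom \<phi>) (with_proj G \<restriction> ran \<phi>)"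

definition rank :: "('a \<rightharpoonup> 'a) \<Rightarrow> nat" where
  "rank \<phi> = card (dom \<phi>)"

definition deficiency :: "'a pair_pre_digraph \<Rightarrow> ('a \<rightharpoonup> 'a) \<Rightarrow> nat" where
  "deficiency G \<phi> = card (pverts G) - rank \<phi>"

definition nontrivial :: "('a \<rightharpoonup> 'a) \<Rightarrow> bool" where
  "nontrivial \<phi> \<longleftrightarrow> (\<exists>x\<in>dom \<phi>. \<phi> x \<noteq> Some x)"

text \<open>
  The second set collects the \<open>v\<close> in the range whose preimage \<open>u\<close>, unique since partial
  automorphisms are injective, differs from \<open>v\<close>.
\<close>

definition supp :: "('a \<rightharpoonup> 'a) \<Rightarrow> 'a set" where
  "supp \<phi> = {v \<in> dom \<phi>. \<phi> v \<noteq> Some v} \<union> {v \<in> ran \<phi>. \<exists>u. \<phi> u = Some v \<and> u \<noteq> v}"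

end

theory Submission
  imports Defs
begin

text \<open>
  The witness is a Hamiltonian cycle \<open>0, 1, \<dots>, 19\<close> with ten chords. The reason why it admits the
  partial automorphism is local. The vertices \<open>0, 1, 2, 8, 9\<close> induce a path in this order. Apart
  from the two edges that join the ends \<open>0\<close> and \<open>9\<close> to their common neighbour \<open>19\<close>, all edges that
  leave the path go to the three vertices \<open>3, 7, 10\<close>. Once these three are deleted, the path hangs
  at its two ends on the single vertex \<open>19\<close>, so that reversing it and fixing everything else is an
  automorphism of what remains. The reversal moves every vertex of the path but the middle one. The
  edges to the deleted vertices, and the way these sit in the rest, can then be chosen so that
  nothing of this symmetry survives in the whole graph.

  The three global properties are each reduced to a small check on the adjacency lists.
  Girth 5 means that there are no triangles, that two distinct vertices have at most one common
  neighbour, and that some pentagon exists (\<open>girth_eq_5I\<close>). For 3-connectivity, deleting two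
  vertices cuts the Hamiltonian cycle into two paths, and a chord between them keeps the graph
  connected (\<open>hamiltonian_chords_imp_3_connected\<close>). For asymmetry, an automorphism preserves the
  set of vertices that lie on no pentagon, hence also the number of walks of length \<open>k\<close> from a
  vertex into this set; for \<open>k = 7\<close> these numbers are pairwise distinct, so every vertex is fixed
  (\<open>asymmetric_if_walk_counts_inj\<close>).
\<close>

section \<open>Girth five\<close>

text \<open>
  A cycle of length 4 is the same as two distinct vertices with two common neighbours, so
  uniqueness of common neighbours takes care of length 4 without an enumeration of 4-cycles.
\<close>

lemma girth_eq_5I:
  fixes G :: "'a pair_pre_digraph"
  assumes graph: "pair_graph G"
    and triangle_free: "\<And>u v w. (u, v) \<in> parcs G \<Longrightarrow> (v, w) \<in> parcs G \<Longrightarrow> (w, u) \<notin> parcs G"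
    and common_nbr: "\<And>u v w x. (u, v) \<in> parcs G \<Longrightarrow> (v, w) \<in> parcs G \<Longrightarrow>
      (u, x) \<in> parcs G \<Longrightarrow> (x, w) \<in> parcs G \<Longrightarrow> u \<noteq> w \<Longrightarrow> v = x"
    and pentagon: "distinct [a, b, c, d, e]" "(a, b) \<in> parcs G" "(b, c) \<in> parcs G"
      "(c, d) \<in> parcs G" "(d, e) \<in> parcs G" "(e, a) \<in> parcs G"
  shows "girth G = 5"
proof -
  interpret pair_graph G by fact
  have "5 \<le> length p" if p: "cycle p" and len: "3 \<le> length p" for p
  proof (rule ccontr)
    assume "\<not> 5 \<le> length p"
    with len have "length p = 3 \<or> length p = 4" by linarith
    then show False
    proof
      assume "length p = 3"
      then obtain x y z where "p = [x, y, z]"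
        by (auto simp: numeral_eq_Suc length_Suc_conv)
      with p show False
        by (cases x; cases y; cases z)
          (auto simp: cycle_def awalk_def dest: triangle_free)
    next
      assume "length p = 4"
      then obtain x y z w where "p = [x, y, z, w]"
        by (auto simp: numeral_eq_Suc length_Suc_conv)
      with p show False
        by (cases x; cases y; cases z; cases w)
          (auto simp: cycle_def awalk_def dest: common_nbr arcs_symmetric)
    qed
  qed
  moreover have "cycle [(a, b), (b, c), (c, d), (d, e), (e, a)]"
    unfolding cycle_def awalk_def
    using pentagon by (intro exI[of _ a]) (auto dest: in_arcsD1)
  ultimately show ?thesis
    unfolding girth_def
    by (intro antisym INF_lower2[where i = "[(a, b), (b, c), (c, d), (d, e), (e, a)]"] INF_greatest)
      (auto simp: numeral_eq_enat)
qed

section \<open>Three-connectivity from a Hamiltonian cycle\<close>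

text \<open>
  Deleting \<open>i < j\<close> splits the rim \<open>0, 1, \<dots>, n - 1, 0\<close> into the inner path strictly between \<open>i\<close>
  and \<open>j\<close> and the outer path, which passes through the closing edge. The chord condition joins
  the two; it is only required for pairs that leave both paths nonempty.
\<close>

lemma hamiltonian_chords_imp_3_connected:
  fixes G :: "nat pair_pre_digraph"
  assumes graph: "pair_graph G"
    and verts: "pverts G = {..<n}" and n: "3 < n"
    and rim: "\<And>i. Suc i < n \<Longrightarrow> (i, Suc i) \<in> parcs G" and closing: "(n - 1, 0) \<in> parcs G"
    and chord: "\<And>i j. i + 1 < j \<Longrightarrow> j < n \<Longrightarrow> \<not> (i = 0 \<and> j = n - 1) \<Longrightarrow>
      \<exists>u w. i < u \<and> u < j \<and> w < n \<and> (w < i \<or> j < w) \<and> (u, w) \<in> parcs G"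
  shows "k_connected 3 G"
proof -
  interpret pair_graph G by fact
  have conn: "connected (with_proj G \<restriction> (pverts G - X))" if X: "X \<subseteq> pverts G" "card X < 3" for X
  proof -
    let ?V = "{..<n} - X"
    define H where "H = with_proj G \<restriction> ?V"
    have H_simps: "verts H = ?V" "(u, v) \<in> arcs_ends H \<longleftrightarrow> (u, v) \<in> parcs G \<and> u \<in> ?V \<and> v \<in> ?V" for u v
      by (auto simp: H_def arcs_ends_conv induce_subgraph_def image_iff with_proj_def)
    have fin: "finite X" using X verts finite_subset by fastforce
    interpret H: sym_digraph H
    proof -
      have "wf_digraph H" unfolding H_def by (rule wellformed_induce_subgraph)
      then show "sym_digraph H"
        by (auto simp: sym_digraph_def sym_digraph_axioms_def symmetric_def H_simps
            intro!: symI dest: arcs_symmetric)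
    qed
    have sym: "u \<rightarrow>\<^sup>*\<^bsub>H\<^esub> v \<Longrightarrow> v \<rightarrow>\<^sup>*\<^bsub>H\<^esub> u" for u v
      by (rule H.symmetric_reachable')
    have arc: "u \<rightarrow>\<^sup>*\<^bsub>H\<^esub> v" if "(u, v) \<in> parcs G" "u \<in> ?V" "v \<in> ?V" for u v
      using that by (intro H.adj_reachable_trans[OF _ H.reachable_refl]) (auto simp: H_simps)
    have refl: "u \<rightarrow>\<^sup>*\<^bsub>H\<^esub> u" if "u \<in> ?V" for u
      using that by (simp add: H_simps)
    have path: "p \<rightarrow>\<^sup>*\<^bsub>H\<^esub> q" if "p \<le> q" "\<And>i. p \<le> i \<Longrightarrow> i \<le> q \<Longrightarrow> i \<in> ?V" for p q
      using that
    proof (induction q rule: dec_induct)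
      case base
      then show ?case by (intro refl) auto
    next
      case (step q)
      then have "p \<rightarrow>\<^sup>*\<^bsub>H\<^esub> q" "(q, Suc q) \<in> parcs G" "q \<in> ?V" "Suc q \<in> ?V"
        using rim by auto
      then show ?case
        using H.reachable_trans arc by blast
    qed
    have all: "u \<rightarrow>\<^sup>*\<^bsub>H\<^esub> v" if uv: "u \<in> ?V" "v \<in> ?V" for u v
    proof (cases "X = {}")
      case True
      with uv path sym show ?thesis
        by (cases "u \<le> v") (auto simp: nat_le_linear)
    next
      case False
      \<comment> \<open>A single deleted vertex is the case \<open>a = b\<close>, in which the inner path is empty.\<close>
      obtain a b where ab: "X = {a, b}" "a \<le> b"
      proof -
        have "card X = 1 \<or> card X = 2"
          using False X fin
          by (metis One_nat_def card_0_eq less_2_cases numeral_2_eq_2 numeral_3_eq_3 less_Suc_eq)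
        then obtain x y where "X = {x, y}"
          by (metis card_1_singletonE card_2_iff insert_absorb2)
        then show thesis
          using that[of x y] that[of y x] by (cases "x \<le> y") (auto simp: insert_commute)
      qed
      have bn: "b < n" using X ab verts by auto
      have inner: "x \<rightarrow>\<^sup>*\<^bsub>H\<^esub> y" if "a < x" "x < b" "a < y" "y < b" for x y
        using path[of x y] path[of y x] sym that ab bn by (cases "x \<le> y") auto
      have low: "x \<rightarrow>\<^sup>*\<^bsub>H\<^esub> 0" if "x < a" for x
        using path[of 0 x] sym that ab bn by auto
      have high: "x \<rightarrow>\<^sup>*\<^bsub>H\<^esub> (n - 1)" if "b < x" "x < n" for x
        using path[of x "n - 1"] that ab bn by auto
      have low_high: "x \<rightarrow>\<^sup>*\<^bsub>H\<^esub> y" if "x < a" "b < y" "y < n" for x y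
      proof -
        have "(n - 1) \<rightarrow>\<^sup>*\<^bsub>H\<^esub> 0" using closing ab bn that by (intro arc) auto
        with low[OF that(1)] sym[OF high[OF that(2,3)]] show ?thesis
          by (meson H.reachable_trans sym)
      qed
      have outer: "x \<rightarrow>\<^sup>*\<^bsub>H\<^esub> y" if "x \<in> ?V" "y \<in> ?V" "x < a \<or> b < x" "y < a \<or> b < y" for x y
      proof -
        have "x < n" "y < n" using that by auto
        with that(3,4) low[of x] low[of y] high[of x] high[of y] low_high[of x y] low_high[of y x]
        show ?thesis by (meson H.reachable_trans sym)
      qed
      have mixed: "x \<rightarrow>\<^sup>*\<^bsub>H\<^esub> y" if xy: "a < x" "x < b" "y \<in> ?V" "y < a \<or> b < y" for x y
      proof -
        have "a + 1 < b" "\<not> (a = 0 \<and> b = n - 1)" using xy bn by auto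
        from chord[OF this(1) bn this(2)] obtain p q where
          pq: "a < p" "p < b" "q < n" "q < a \<or> b < q" "(p, q) \<in> parcs G" by blast
        have "x \<rightarrow>\<^sup>*\<^bsub>H\<^esub> p" using inner xy pq by blast
        moreover have "p \<rightarrow>\<^sup>*\<^bsub>H\<^esub> q" using arc pq ab bn by auto
        moreover have "q \<rightarrow>\<^sup>*\<^bsub>H\<^esub> y" using outer xy pq ab by auto
        ultimately show ?thesis using H.reachable_trans by blast
      qed
      have side: "(a < x \<and> x < b) \<or> x < a \<or> b < x" if "x \<in> ?V" for x
        using that ab by auto
      from side[OF uv(1)] side[OF uv(2)] inner[of u v] outer[OF uv] mixed[of u v] mixed[of v u] uv
      show ?thesis by (meson sym)
    qed
    have "?V \<noteq> {}"
    proof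
      assume "?V = {}"
      then have "{..<n} \<subseteq> X" by blast
      then have "n \<le> card X" using card_mono[OF fin, of "{..<n}"] by simp
      with X n show False by simp
    qed
    with all have "strongly_connected H"
      by (auto simp: strongly_connected_def H_simps)
    then have "connected H"
      by (simp add: connected_def strongly_connected_def H.reachable_mk_symmetric_eq[OF H.sym_arcs])
    then show ?thesis by (simp add: H_def verts)
  qed
  then show ?thesis using n verts by (simp add: k_connected_def)
qed

section \<open>Counting walks into an invariant set\<close>

fun walks_into :: "'a pair_pre_digraph \<Rightarrow> 'a set \<Rightarrow> nat \<Rightarrow> 'a \<Rightarrow> nat" where
  "walks_into G S 0 v = (if v \<in> S then 1 else 0)"
| "walks_into G S (Suc k) v = (\<Sum>u | (v, u) \<in> parcs G. walks_into G S k u)"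

text \<open>
  In a loop-free graph without triangles the closed walks of length 5 are exactly the pentagons.
  Described as a closed walk, a pentagon is visibly carried to a pentagon by every automorphism.
\<close>

definition pentagonal :: "'a pair_pre_digraph \<Rightarrow> 'a \<Rightarrow> bool" where
  "pentagonal G v \<longleftrightarrow> (\<exists>a b c d. (v, a) \<in> parcs G \<and> (a, b) \<in> parcs G \<and> (b, c) \<in> parcs G \<and>
     (c, d) \<in> parcs G \<and> (d, v) \<in> parcs G)"

text \<open>
  An automorphism that preserves \<open>S\<close> maps the neighbours of \<open>v\<close> bijectively to those of \<open>f v\<close>, so
  the two recursive sums agree term by term.
\<close>

lemma walks_into_isomorphism:
  fixes G :: "'a pair_pre_digraph"
  assumes graph: "pair_graph G"
    and bij: "bij_betw f (pverts G) (pverts G)"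
    and arcs: "\<And>u v. u \<in> pverts G \<Longrightarrow> v \<in> pverts G \<Longrightarrow> (f u, f v) \<in> parcs G \<longleftrightarrow> (u, v) \<in> parcs G"
    and S: "\<And>v. v \<in> pverts G \<Longrightarrow> f v \<in> S \<longleftrightarrow> v \<in> S"
    and v: "v \<in> pverts G"
  shows "walks_into G S k (f v) = walks_into G S k v"
  using v
proof (induction k arbitrary: v)
  case 0
  then show ?case using S by simp
next
  case (Suc k)
  interpret pair_graph G by fact
  have "bij_betw f {u. (v, u) \<in> parcs G} {u. (f v, u) \<in> parcs G}"
    unfolding bij_betw_def
  proof
    show "inj_on f {u. (v, u) \<in> parcs G}"
      using bij by (auto simp: bij_betw_def dest: in_arcsD2 intro: inj_on_subset)
    show "f ` {u. (v, u) \<in> parcs G} = {u. (f v, u) \<in> parcs G}" (is "?A = ?B")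
    proof
      show "?A \<subseteq> ?B" using arcs Suc.prems by (auto dest: in_arcsD2)
      show "?B \<subseteq> ?A"
      proof
        fix w assume w: "w \<in> ?B"
        then have "w \<in> f ` pverts G" using bij by (auto simp: bij_betw_def dest: in_arcsD2)
        with w arcs Suc.prems show "w \<in> ?A" by auto
      qed
    qed
  qed
  from sum.reindex_bij_betw[OF this, of "walks_into G S k", symmetric]
  have "walks_into G S (Suc k) (f v) = (\<Sum>u | (v, u) \<in> parcs G. walks_into G S k (f u))"
    by simp
  also have "\<dots> = walks_into G S (Suc k) v"
    using Suc.IH by (auto intro!: sum.cong dest: in_arcsD2)
  finally show ?case .
qed

lemma pentagonal_isomorphism:
  fixes G :: "'a pair_pre_digraph"
  assumes graph: "pair_graph G"
    and bij: "bij_betw f (pverts G) (pverts G)"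
    and arcs: "\<And>u v. u \<in> pverts G \<Longrightarrow> v \<in> pverts G \<Longrightarrow> (f u, f v) \<in> parcs G \<longleftrightarrow> (u, v) \<in> parcs G"
    and v: "v \<in> pverts G"
  shows "pentagonal G (f v) \<longleftrightarrow> pentagonal G v"
proof -
  interpret pair_graph G by fact
  have V: "u \<in> pverts G \<and> w \<in> pverts G" if "(u, w) \<in> parcs G" for u w
    using that by (auto dest: wellformed')
  have onto: "\<exists>u\<in>pverts G. w = f u" if "w \<in> pverts G" for w
    using that bij by (auto simp: bij_betw_def)
  show ?thesis
  proof
    assume "pentagonal G v"
    then show "pentagonal G (f v)" unfolding pentagonal_def using arcs V by metis
  next
    assume "pentagonal G (f v)"
    then obtain a b c d where "(f v, a) \<in> parcs G" "(a, b) \<in> parcs G" "(b, c) \<in> parcs G"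
      "(c, d) \<in> parcs G" "(d, f v) \<in> parcs G" unfolding pentagonal_def by blast
    moreover from this obtain a' b' c' d' where "a = f a'" "b = f b'" "c = f c'" "d = f d'"
      "{a', b', c', d'} \<subseteq> pverts G"
      using onto[of a] onto[of b] onto[of c] onto[of d] V by auto
    ultimately show "pentagonal G v" unfolding pentagonal_def using arcs v
      by (intro exI[of _ a'] exI[of _ b'] exI[of _ c'] exI[of _ d']) auto
  qed
qed

text \<open>
  In a regular graph the total number of walks of a given length is the same at every vertex, so
  the walks have to be restricted by where they end. The vertices on no pentagon form a set that
  every automorphism preserves.
\<close>

lemma asymmetric_if_walk_counts_inj:
  fixes G :: "'a pair_pre_digraph"
  assumes graph: "pair_graph G"
    and inj: "inj_on (walks_into G {v \<in> pverts G. \<not> pentagonal G v} k) (pverts G)"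
  shows "asymmetric G"
  unfolding asymmetric_def
proof (intro allI impI ballI)
  fix f v
  assume f: "graph_isomorphism f (with_proj G) (with_proj G)" and v: "v \<in> pverts G"
  let ?S = "{v \<in> pverts G. \<not> pentagonal G v}"
  have bij: "bij_betw f (pverts G) (pverts G)"
    and arcs: "\<And>u v. u \<in> pverts G \<Longrightarrow> v \<in> pverts G \<Longrightarrow> (f u, f v) \<in> parcs G \<longleftrightarrow> (u, v) \<in> parcs G"
    using f by (auto simp: graph_isomorphism_def)
  have fv: "f u \<in> pverts G" if "u \<in> pverts G" for u
    using bij that by (auto simp: bij_betw_def)
  have "walks_into G ?S k (f v) = walks_into G ?S k v"
    using pentagonal_isomorphism[OF graph bij arcs] fv v
    by (intro walks_into_isomorphism[OF graph bij arcs]) auto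
  with inj v fv show "f v = v" by (auto dest: inj_onD)
qed

section \<open>The graph\<close>

text \<open>
  Each list starts with the two neighbours on the Hamiltonian cycle; its last entry is the other
  end of the chord.
\<close>

definition nbrs :: "nat \<Rightarrow> nat list" where
  "nbrs v = [[19, 1, 7], [0, 2, 10], [1, 3, 8], [2, 4, 15], [3, 5, 11], [4, 6, 17], [5, 7, 13],
     [6, 8, 0], [7, 9, 2], [8, 10, 19], [9, 11, 1], [10, 12, 4], [11, 13, 16], [12, 14, 6],
     [13, 15, 18], [14, 16, 3], [15, 17, 12], [16, 18, 5], [17, 19, 14], [18, 0, 9]] ! v"

definition chorded_cycle :: "nat pair_pre_digraph" where
  "chorded_cycle = \<lparr>pverts = {..<20}, parcs = {(u, v). u < 20 \<and> v \<in> set (nbrs u)}\<rparr>"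

lemma chorded_cycle_simps [simp]:
  "pverts chorded_cycle = {..<20}" "(u, v) \<in> parcs chorded_cycle \<longleftrightarrow> u < 20 \<and> v \<in> set (nbrs u)"
  by (auto simp: chorded_cycle_def)

lemma nbrs_less: "v < 20" if "v \<in> set (nbrs u)" "u < 20"
proof -
  have "\<forall>u<20. \<forall>v\<in>set (nbrs u). v < 20" by code_simp
  with that show ?thesis by blast
qed

lemma nbrs_sym: "u \<in> set (nbrs v)" if "v \<in> set (nbrs u)" "u < 20"
proof -
  have "\<forall>u<20. \<forall>v\<in>set (nbrs u). u \<in> set (nbrs v)" by code_simp
  with that show ?thesis by blast
qed

lemma nbrs_distinct: "distinct (u # nbrs u) \<and> length (nbrs u) = 3" if "u < 20"
proof -
  have "\<forall>u<20. distinct (u # nbrs u) \<and> length (nbrs u) = 3" by code_simp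
  with that show ?thesis by blast
qed

lemma pair_graph_chorded_cycle: "pair_graph chorded_cycle"
proof
  have "parcs chorded_cycle \<subseteq> {..<20} \<times> {..<20}" by (auto simp: chorded_cycle_def dest: nbrs_less)
  then show "finite (parcs chorded_cycle)" by (rule finite_subset) auto
qed (use nbrs_distinct in \<open>auto simp: chorded_cycle_def symmetric_def dest: nbrs_less nbrs_sym intro!: symI\<close>)


lemma chorded_cycle_cubic: "cubic chorded_cycle"
  unfolding cubic_def
proof
  fix v assume "v \<in> pverts chorded_cycle"
  then have v: "v < 20" by simp
  then have "out_arcs (with_proj chorded_cycle) v = Pair v ` set (nbrs v)"
    by (auto simp: out_arcs_def chorded_cycle_def)
  moreover have "card (set (nbrs v)) = 3"
    using nbrs_distinct[OF v] by (metis distinct.simps(2) distinct_card)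
  ultimately show "out_degree (with_proj chorded_cycle) v = 3"
    by (simp add: out_degree_def card_image inj_on_def)
qed

lemma chorded_cycle_girth: "girth chorded_cycle = 5"
proof -
  have triangle: "\<forall>u<20. \<forall>v\<in>set (nbrs u). \<forall>w\<in>set (nbrs v). u \<notin> set (nbrs w)"
    by code_simp
  have square: "\<forall>u<20. \<forall>v\<in>set (nbrs u). \<forall>w\<in>set (nbrs v). \<forall>x\<in>set (nbrs u).
      w \<in> set (nbrs x) \<longrightarrow> u = w \<or> v = x"
    by code_simp
  \<comment> \<open>The chords \<open>{0, 7}\<close> and \<open>{2, 8}\<close> give the pentagon \<open>0, 1, 2, 8, 7\<close>.\<close>
  show ?thesis
  proof (rule girth_eq_5I[OF pair_graph_chorded_cycle, of 0 1 2 8 7])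
    show "(w, u) \<notin> parcs chorded_cycle"
      if "(u, v) \<in> parcs chorded_cycle" "(v, w) \<in> parcs chorded_cycle" for u v w
      using triangle[rule_format, of u v w] that unfolding chorded_cycle_simps by blast
    show "v = x" if "(u, v) \<in> parcs chorded_cycle" "(v, w) \<in> parcs chorded_cycle"
      "(u, x) \<in> parcs chorded_cycle" "(x, w) \<in> parcs chorded_cycle" "u \<noteq> w" for u v w x
      using square[rule_format, of u v w x] that unfolding chorded_cycle_simps by blast
  qed (simp_all add: nbrs_def)
qed

lemma chorded_cycle_3_connected: "k_connected 3 chorded_cycle"
proof (rule hamiltonian_chords_imp_3_connected[OF pair_graph_chorded_cycle, of 20])
  have "\<forall>i<19. Suc i \<in> set (nbrs i)" by code_simp
  then show "(i, Suc i) \<in> parcs chorded_cycle" if "Suc i < 20" for i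
    using that by simp
  \<comment> \<open>The excluded pair \<open>0, 19\<close> is adjacent through the closing edge, so its outer path is empty.\<close>
  have chords: "list_all (\<lambda>i. list_all (\<lambda>j. i = 0 \<and> j = 19 \<or>
      list_ex (\<lambda>u. list_ex (\<lambda>w. w < i \<or> j < w) (nbrs u)) [Suc i..<j]) [i + 2..<20]) [0..<20]"
    by code_simp
  show "\<exists>u w. i < u \<and> u < j \<and> w < 20 \<and> (w < i \<or> j < w) \<and> (u, w) \<in> parcs chorded_cycle"
    if "i + 1 < j" "j < 20" "\<not> (i = 0 \<and> j = 20 - 1)" for i j
  proof -
    have "i \<in> set [0..<20]" "j \<in> set [i + 2..<20]" "\<not> (i = 0 \<and> j = 19)" using that by auto
    with chords obtain u w where
      "u \<in> set [Suc i..<j]" "w \<in> set (nbrs u)" "w < i \<or> j < w"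
      unfolding list_all_iff list_ex_iff by blast
    moreover from this that have "u < 20" "w < 20" using nbrs_less by auto
    ultimately show ?thesis by (intro exI[of _ u] exI[of _ w]) auto
  qed
qed (simp_all add: nbrs_def)

lemma not_pentagonal_chorded_cycle:
  "{v \<in> pverts chorded_cycle. \<not> pentagonal chorded_cycle v} = {3, 4, 5, 6, 11}"
proof -
  have "\<forall>v<20. (\<exists>a\<in>set (nbrs v). \<exists>b\<in>set (nbrs a). \<exists>c\<in>set (nbrs b). \<exists>d\<in>set (nbrs c).
      v \<in> set (nbrs d)) \<longleftrightarrow> v \<notin> set [3, 4, 5, 6, 11]"
    by code_simp
  moreover have "pentagonal chorded_cycle v \<longleftrightarrow> (\<exists>a\<in>set (nbrs v). \<exists>b\<in>set (nbrs a). \<exists>c\<in>set (nbrs b).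
      \<exists>d\<in>set (nbrs c). v \<in> set (nbrs d))" if "v < 20" for v
    using that unfolding pentagonal_def chorded_cycle_simps by (meson nbrs_less)
  ultimately have "pentagonal chorded_cycle v \<longleftrightarrow> v \<notin> set [3, 4, 5, 6, 11]" if "v < 20" for v
    using that by blast
  then show ?thesis by auto
qed

text \<open>
  One step of walk counting for all vertices at once. The direct recursion would visit each of the
  \<open>3 ^ 7\<close> walks from every vertex, whereas seven updates of a vector of counts reach the same
  numbers.
\<close>

definition nbr_sums :: "nat list \<Rightarrow> nat list" where
  "nbr_sums c = map (\<lambda>v. sum_list (map ((!) c) (nbrs v))) [0..<20]"

lemma walks_into_chorded_cycle:
  "map (walks_into chorded_cycle (set xs) k) [0..<20] =
     (nbr_sums ^^ k) (map (\<lambda>v. if v \<in> set xs then 1 else 0) [0..<20])"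
proof (induction k)
  case 0
  then show ?case by simp
next
  case (Suc k)
  have "walks_into chorded_cycle (set xs) (Suc k) v =
      sum_list (map ((!) (map (walks_into chorded_cycle (set xs) k) [0..<20])) (nbrs v))"
    if v: "v < 20" for v
  proof -
    have "{u. (v, u) \<in> parcs chorded_cycle} = set (nbrs v)" using v by simp
    moreover have "distinct (nbrs v)" using nbrs_distinct[OF v] by simp
    ultimately have "walks_into chorded_cycle (set xs) (Suc k) v =
        sum_list (map (walks_into chorded_cycle (set xs) k) (nbrs v))"
      by (simp add: sum_list_distinct_conv_sum_set del: chorded_cycle_simps)
    also have "map (walks_into chorded_cycle (set xs) k) (nbrs v) =
        map ((!) (map (walks_into chorded_cycle (set xs) k) [0..<20])) (nbrs v)"
      using v by (auto dest: nbrs_less)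
    finally show ?thesis .
  qed
  then have "map (walks_into chorded_cycle (set xs) (Suc k)) [0..<20] =
      nbr_sums (map (walks_into chorded_cycle (set xs) k) [0..<20])"
    unfolding nbr_sums_def by (intro map_cong) auto
  then show ?case by (simp only: Suc.IH funpow.simps o_apply)
qed

lemma upt_20: "[0..<20] = [0, 1, 2, 3, 4, 5, 6, 7, 8, 9, 10, 11, 12, 13, 14, 15, 16, 17, 18, 19::nat]"
  by (simp add: upt_rec)

lemma nbr_sums_list:
  "nbr_sums
    [x0, x1, x2, x3, x4, x5, x6, x7, x8, x9, x10, x11, x12, x13, x14, x15, x16, x17, x18, x19] =
    [x19 + x1 + x7, x0 + x2 + x10, x1 + x3 + x8, x2 + x4 + x15, x3 + x5 + x11, x4 + x6 + x17,
     x5 + x7 + x13, x6 + x8 + x0, x7 + x9 + x2, x8 + x10 + x19, x9 + x11 + x1, x10 + x12 + x4,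
     x11 + x13 + x16, x12 + x14 + x6, x13 + x15 + x18, x14 + x16 + x3, x15 + x17 + x12,
     x16 + x18 + x5, x17 + x19 + x14, x18 + x0 + x9]"
  unfolding nbr_sums_def upt_20 nbrs_def by simp

lemma nbr_sums_7:
  "(nbr_sums ^^ 7) (map (\<lambda>v. if v \<in> set [3, 4, 5, 6, 11] then 1 else 0) [0..<20]) =
    [473, 402, 613, 458, 751, 536, 601, 501, 430, 445, 584, 486, 701, 571, 535, 706, 506, 663,
     512, 461]"
proof -
  have seven: "(7::nat) = Suc (Suc (Suc (Suc (Suc (Suc (Suc 0))))))" by simp
  show ?thesis
    unfolding upt_20 seven funpow.simps o_apply id_apply by (simp add: nbr_sums_list)
qed

lemma chorded_cycle_asymmetric: "asymmetric chorded_cycle"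
proof (rule asymmetric_if_walk_counts_inj[OF pair_graph_chorded_cycle, of 7])
  have "distinct ((nbr_sums ^^ 7) (map (\<lambda>v. if v \<in> set [3, 4, 5, 6, 11] then 1 else 0) [0..<20]))"
    unfolding nbr_sums_7 by simp
  then have "distinct (map (walks_into chorded_cycle (set [3, 4, 5, 6, 11]) 7) [0..<20])"
    by (simp only: walks_into_chorded_cycle)
  then show "inj_on (walks_into chorded_cycle {v \<in> pverts chorded_cycle. \<not> pentagonal chorded_cycle v} 7)
      (pverts chorded_cycle)"
    unfolding not_pentagonal_chorded_cycle by (simp add: distinct_map atLeast0LessThan)
qed

section \<open>The partial automorphism\<close>

definition flip :: "nat \<Rightarrow> nat" where
  "flip v = (if v = 0 then 9 else if v = 9 then 0 else if v = 1 then 8 else if v = 8 then 1 else v)"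

text \<open>
  The reversal of the path \<open>0, 1, 2, 8, 9\<close>, restricted to the complement of the three vertices
  \<open>3, 7, 10\<close> that would distinguish the path from its reverse.
\<close>

definition path_flip :: "nat \<rightharpoonup> nat" where
  "path_flip = (Some \<circ> flip) |` ({..<20} - {3, 7, 10})"

lemma flip_flip [simp]: "flip (flip v) = v"
  by (simp add: flip_def)

lemma dom_path_flip: "dom path_flip = {..<20} - {3, 7, 10}"
  by (auto simp: path_flip_def restrict_map_def split: if_splits)

lemma flip_dom: "flip v \<in> dom path_flip \<longleftrightarrow> v \<in> dom path_flip"
  by (auto simp: dom_path_flip flip_def)

lemma path_flip_apply: "v \<in> dom path_flip \<Longrightarrow> path_flip v = Some (flip v)"
  unfolding dom_path_flip by (simp add: path_flip_def)

lemma ran_path_flip: "ran path_flip = dom path_flip"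
proof -
  have "path_flip u = Some v \<longleftrightarrow> v \<in> dom path_flip \<and> u = flip v" for u v
    by (metis domI flip_dom flip_flip option.inject path_flip_apply)
  then show ?thesis by (auto simp: ran_def)
qed

text \<open>The domain as an explicit list, for deciding statements about all its vertices.\<close>

lemma dom_path_flip_set: "dom path_flip = set [0, 1, 2, 4, 5, 6, 8, 9, 11, 12, 13, 14, 15, 16, 17, 18, 19]"
  unfolding dom_path_flip by (auto simp: lessThan_nat_numeral lessThan_Suc)

lemma card_dom_path_flip: "card (dom path_flip) = 17"
  unfolding dom_path_flip_set by simp

lemma partial_automorphism_path_flip: "partial_automorphism chorded_cycle path_flip"
  unfolding partial_automorphism_def graph_isomorphism_def
proof (intro conjI ballI)
  let ?H = "with_proj chorded_cycle \<restriction> dom path_flip"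
  show "dom path_flip \<subseteq> pverts chorded_cycle" "ran path_flip \<subseteq> pverts chorded_cycle"
    by (auto simp: ran_path_flip dom_path_flip)
  have "bij_betw flip (dom path_flip) (dom path_flip)"
    by (rule bij_betw_byWitness[of _ flip]) (simp_all add: flip_dom image_subset_iff)
  then show "bij_betw (\<lambda>v. the (path_flip v)) (verts ?H) (verts (with_proj chorded_cycle \<restriction> ran path_flip))"
    by (subst bij_betw_cong[where g = flip]) (simp_all add: ran_path_flip path_flip_apply)
  fix u v assume "u \<in> verts ?H" "v \<in> verts ?H"
  then have uv: "u \<in> dom path_flip" "v \<in> dom path_flip" by simp_all
  have adj: "a \<rightarrow>\<^bsub>?H\<^esub> b \<longleftrightarrow> b \<in> set (nbrs a)"
    if "a \<in> dom path_flip" "b \<in> dom path_flip" for a b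
    using that by (auto simp: arcs_ends_conv induce_subgraph_def image_iff with_proj_def dom_path_flip)
  have "\<forall>u\<in>set xs. \<forall>v\<in>set xs. v \<in> set (nbrs u) \<longleftrightarrow> flip v \<in> set (nbrs (flip u))"
    if "xs = [0, 1, 2, 4, 5, 6, 8, 9, 11, 12, 13, 14, 15, 16, 17, 18, 19]" for xs
    unfolding that by code_simp
  then have "v \<in> set (nbrs u) \<longleftrightarrow> flip v \<in> set (nbrs (flip u))"
    using uv unfolding dom_path_flip_set by blast
  then show "u \<rightarrow>\<^bsub>?H\<^esub> v \<longleftrightarrow>
      the (path_flip u) \<rightarrow>\<^bsub>with_proj chorded_cycle \<restriction> ran path_flip\<^esub> the (path_flip v)"
    using uv by (simp add: ran_path_flip path_flip_apply adj flip_dom)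
qed

lemma supp_path_flip: "supp path_flip = {0, 1, 8, 9}"
proof -
  have "supp path_flip = {v \<in> dom path_flip. flip v \<noteq> v}"
  proof -
    have "path_flip v \<noteq> Some v \<longleftrightarrow> flip v \<noteq> v" if "v \<in> dom path_flip" for v
      using that by (simp add: path_flip_apply)
    moreover have "path_flip u = Some v \<Longrightarrow> u \<noteq> v \<Longrightarrow> flip v \<noteq> v" for u v
      by (metis domI flip_flip option.inject path_flip_apply)
    ultimately show ?thesis unfolding supp_def ran_path_flip by blast
  qed
  also have "\<dots> = {0, 1, 8, 9}"
    by (auto simp: dom_path_flip flip_def split: if_splits)
  finally show ?thesis .
qed

text \<open>
  The other five edges that leave the path end in the deleted vertices, which belong to neither
  side.
\<close>

lemma edges_between_path_and_rest:
  "edges_between chorded_cycle {0, 1, 2, 8, 9} {4, 5, 6, 11, 12, 13, 14, 15, 16, 17, 18, 19} =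
     {{0, 19}, {9, 19}}" (is "edges_between _ ?C ?R = _")
proof -
  have "\<forall>u\<in>set [0, 1, 2, 8, 9]. \<forall>v\<in>set [4, 5, 6, 11, 12, 13, 14, 15, 16, 17, 18, 19].
      v \<in> set (nbrs u) \<longleftrightarrow> v = 19 \<and> (u = 0 \<or> u = 9)"
    by code_simp
  then have "u \<in> ?C \<and> v \<in> ?R \<and> (u, v) \<in> parcs chorded_cycle \<longleftrightarrow> v = 19 \<and> (u = 0 \<or> u = 9)" for u v
    by auto
  then show ?thesis unfolding edges_between_def by auto
qed

theorem proposition2:
  shows "\<exists>G :: nat pair_pre_digraph.
    pair_graph G \<and> asymmetric G \<and> cubic G \<and> k_connected 3 G \<and> girth G = 5 \<and> card (pverts G) = 20 \<and>
    (\<exists>\<phi>. partial_automorphism G \<phi> \<and> nontrivial \<phi> \<and> deficiency G \<phi> = 3 \<and> rank \<phi> = 17 \<and>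
         card (supp \<phi>) = 4 \<and>
         (\<exists>C R. dom \<phi> = C \<union> R \<and> C \<inter> R = {} \<and> card C = 5 \<and> supp \<phi> \<subseteq> C \<and>
                card R = 12 \<and> (\<forall>v\<in>R. \<phi> v = Some v) \<and> card (edges_between G C R) = 2)) \<and>
    \<not> (\<forall>\<phi> k. k \<in> {1, 2, 3} \<and> partial_automorphism G \<phi> \<and> nontrivial \<phi> \<and> deficiency G \<phi> = k \<longrightarrow>
         \<not> (\<exists>C R. dom \<phi> = C \<union> R \<and> C \<inter> R = {} \<and> supp \<phi> \<subseteq> C \<and> (\<forall>v\<in>R. \<phi> v = Some v) \<and>
                  card R \<ge> 6 \<and> card (edges_between G C R) \<le> 5 - k))"
proof -
  let ?C = "{0, 1, 2, 8, 9} :: nat set"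
  let ?R = "{4, 5, 6, 11, 12, 13, 14, 15, 16, 17, 18, 19} :: nat set"
  have "{0::nat, 19} \<noteq> {9, 19}" by (simp add: doubleton_eq_iff)
  then have two_edges: "card (edges_between chorded_cycle ?C ?R) = 2"
    unfolding edges_between_path_and_rest by simp
  have split: "dom path_flip = ?C \<union> ?R" "?C \<inter> ?R = {}" "supp path_flip \<subseteq> ?C"
    by (auto simp: dom_path_flip_set supp_path_flip)
  have fixed: "\<forall>v\<in>?R. path_flip v = Some v"
    using split(1) by (auto simp: path_flip_apply flip_def)
  have card_R: "card ?R = 12" by simp
  have at_least_6: "6 \<le> card ?R" unfolding card_R by simp
  have at_most_2: "card (edges_between chorded_cycle ?C ?R) \<le> 5 - 3" unfolding two_edges by simp
  have rank: "rank path_flip = 17" by (simp add: rank_def card_dom_path_flip)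
  then have deficiency: "deficiency chorded_cycle path_flip = 3" by (simp add: deficiency_def)
  have "0 \<in> dom path_flip" unfolding dom_path_flip by simp
  moreover from path_flip_apply[OF this] have "path_flip 0 \<noteq> Some 0" by (simp add: flip_def)
  ultimately have nontrivial: "nontrivial path_flip" unfolding nontrivial_def by blast
  have few_edges: "\<exists>C R. dom path_flip = C \<union> R \<and> C \<inter> R = {} \<and> supp path_flip \<subseteq> C \<and>
      (\<forall>v\<in>R. path_flip v = Some v) \<and> card R \<ge> 6 \<and> card (edges_between chorded_cycle C R) \<le> 5 - 3"
    by (rule exI[of _ ?C], rule exI[of _ ?R], intro conjI split fixed at_least_6 at_most_2)
  show ?thesis
  proof (rule exI[of _ chorded_cycle], intro conjI)
    show "card (pverts chorded_cycle) = 20" by simp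
    show "\<exists>\<phi>. partial_automorphism chorded_cycle \<phi> \<and> nontrivial \<phi> \<and>
        deficiency chorded_cycle \<phi> = 3 \<and> rank \<phi> = 17 \<and> card (supp \<phi>) = 4 \<and>
        (\<exists>C R. dom \<phi> = C \<union> R \<and> C \<inter> R = {} \<and> card C = 5 \<and> supp \<phi> \<subseteq> C \<and>
          card R = 12 \<and> (\<forall>v\<in>R. \<phi> v = Some v) \<and> card (edges_between chorded_cycle C R) = 2)"
    proof (rule exI[of _ path_flip], intro conjI)
      show "card (supp path_flip) = 4" by (simp add: supp_path_flip)
      show "\<exists>C R. dom path_flip = C \<union> R \<and> C \<inter> R = {} \<and> card C = 5 \<and> supp path_flip \<subseteq> C \<and>
          card R = 12 \<and> (\<forall>v\<in>R. path_flip v = Some v) \<and> card (edges_between chorded_cycle C R) = 2"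
        by (rule exI[of _ ?C], rule exI[of _ ?R], intro conjI split two_edges fixed card_R) simp
    qed (fact partial_automorphism_path_flip nontrivial deficiency rank)+
    show "\<not> (\<forall>\<phi> k. k \<in> {1, 2, 3} \<and> partial_automorphism chorded_cycle \<phi> \<and> nontrivial \<phi> \<and>
        deficiency chorded_cycle \<phi> = k \<longrightarrow>
        \<not> (\<exists>C R. dom \<phi> = C \<union> R \<and> C \<inter> R = {} \<and> supp \<phi> \<subseteq> C \<and> (\<forall>v\<in>R. \<phi> v = Some v) \<and>
          card R \<ge> 6 \<and> card (edges_between chorded_cycle C R) \<le> 5 - k))"
    proof
      assume "\<forall>\<phi> k. k \<in> {1, 2, 3} \<and> partial_automorphism chorded_cycle \<phi> \<and> nontrivial \<phi> \<and>
        deficiency chorded_cycle \<phi> = k \<longrightarrow>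
        \<not> (\<exists>C R. dom \<phi> = C \<union> R \<and> C \<inter> R = {} \<and> supp \<phi> \<subseteq> C \<and> (\<forall>v\<in>R. \<phi> v = Some v) \<and>
          card R \<ge> 6 \<and> card (edges_between chorded_cycle C R) \<le> 5 - k)"
      then have "3 \<in> {1, 2, 3::nat} \<and> partial_automorphism chorded_cycle path_flip \<and>
        nontrivial path_flip \<and> deficiency chorded_cycle path_flip = 3 \<longrightarrow>
        \<not> (\<exists>C R. dom path_flip = C \<union> R \<and> C \<inter> R = {} \<and> supp path_flip \<subseteq> C \<and>
          (\<forall>v\<in>R. path_flip v = Some v) \<and> card R \<ge> 6 \<and> card (edges_between chorded_cycle C R) \<le> 5 - 3)"
        by (elim allE)
      moreover have "(3::nat) \<in> {1, 2, 3}" by simp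
      ultimately show False
        using partial_automorphism_path_flip nontrivial deficiency few_edges by argo
    qed
  qed (fact pair_graph_chorded_cycle chorded_cycle_asymmetric chorded_cycle_cubic
    chorded_cycle_3_connected chorded_cycle_girth)+
qed

end
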